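(* Let $f:\omega\to\omega$ be not generically computable and let $X\subseteq\omega$ be $1$-generic relative to $f$. Then there is no partial $X$-computable generic description of $f$. Consequently, for every set $A\subseteq\omega$ that is not generically computable, the classes $\{X: A\le_{\mathrm{ug}} X\}$ and $\{X: A\le_{\mathrm{ng}} X\}$ are meager.
   Context: For $C\subseteq\omega$, $\rho_n(C)=|C\cap\{0,\dots,n-1\}|/n$ and $\rho(C)=\lim_n\rho_n(C)$ when it exists. A generic description of $g$ is a partial function $d$ with $d(n)=g(n)$ for all $n\in\mathrm{dom}\,d$ and $\rho(\mathrm{dom}\,d)=1$; $g$ is generically computable if it has a partial computable generic description. $X$ is $1$-generic relative to $f$ if for every $f$-c.e. set $S$ of finite binary strings, either some initial segment of $X$ lies in $S$, or some initial segment of $X$ has no extension in $S$. An enumeration operator is a c.e. set $W$ of pairs $(F,k)$, $F$ finite, with $W^Y=\{k:\exists(F,k)\in W,\,F\subseteq Y\}$. $h\le_{\mathrm{ng}} g$: every generic description $d$ of $g$ has a generic description $e$ of $h$ with $\mathrm{gra}(e)=W^{\mathrm{gra}(d)}$ for some enumeration operator $W$; $h\le_{\mathrm{ug}} g$: a single enumeration operator $W$ works for all generic descriptions $d$ of $g$. Sets are identified with characteristic functions; meagerness is in the Cantor space topology on $2^\omega$. *)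

theory Defs
  imports
    "HOL-Analysis.Analysis"
    "HOL-Library.Nat_Bijection"
    "HOL-Library.Sublist"
begin

text \<open>
  Relative computability is Kleene's: the partial functions recursive in an oracle
  \<open>g\<close> are those obtained from zero, successor, projections and \<open>g\<close> itself
  by composition, primitive recursion and unbounded minimisation. Arities are not part of
  the syntax: zero and the projections exist at every arity, and an initial function applied
  to an argument list it does not fit is undefined.
\<close>

datatype recfn =
    Zero
  | Succ
  | Oracle
  | Proj nat
  | Comp recfn "recfn list"
  | PrimRec recfn recfn
  | Minim recfn

fun run :: "(nat \<Rightarrow> nat) \<Rightarrow> recfn \<Rightarrow> nat list \<Rightarrow> nat option" where
  "run g Zero xs = Some 0"
| "run g Succ xs = (case xs of [x] \<Rightarrow> Some (Suc x) | _ \<Rightarrow> None)"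
| "run g Oracle xs = (case xs of [x] \<Rightarrow> Some (g x) | _ \<Rightarrow> None)"
| "run g (Proj i) xs = (if i < length xs then Some (xs ! i) else None)"
| "run g (Comp p qs) xs =
     (if \<forall>q \<in> set qs. run g q xs \<noteq> None
      then run g p (map (\<lambda>q. the (run g q xs)) qs) else None)"
| "run g (PrimRec b s) xs =
     (case xs of
        [] \<Rightarrow> None
      | n # ys \<Rightarrow>
          rec_nat (run g b ys)
            (\<lambda>m r. case r of None \<Rightarrow> None | Some v \<Rightarrow> run g s (m # v # ys)) n)"
| "run g (Minim p) xs =
     (if \<exists>n. run g p (n # xs) = Some 0 \<and> (\<forall>m<n. \<exists>v. run g p (m # xs) = Some (Suc v))
      then Some (LEAST n. run g p (n # xs) = Some 0) else None)"

definition partial_computable_in :: "(nat \<Rightarrow> nat) \<Rightarrow> (nat \<rightharpoonup> nat) \<Rightarrow> bool" where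
  "partial_computable_in g d \<longleftrightarrow> (\<exists>p. \<forall>n. d n = run g p [n])"

text \<open>With the zero function as oracle, \<^const>\<open>Oracle\<close> adds nothing to the other
  initial functions, so this is absolute computability.\<close>

definition partial_computable :: "(nat \<rightharpoonup> nat) \<Rightarrow> bool" where
  "partial_computable d \<longleftrightarrow> partial_computable_in (\<lambda>_. 0) d"

definition ce_in :: "(nat \<Rightarrow> nat) \<Rightarrow> nat set \<Rightarrow> bool" where
  "ce_in g S \<longleftrightarrow> (\<exists>d. partial_computable_in g d \<and> S = dom d)"

definition ce :: "nat set \<Rightarrow> bool" where
  "ce S \<longleftrightarrow> (\<exists>d. partial_computable d \<and> S = dom d)"

definition char_fun :: "nat set \<Rightarrow> nat \<Rightarrow> nat" where
  "char_fun X n = (if n \<in> X then 1 else 0)"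

definition initial_density :: "nat \<Rightarrow> nat set \<Rightarrow> real" where
  "initial_density n C = real (card (C \<inter> {..<n})) / real n"

definition has_density :: "nat set \<Rightarrow> real \<Rightarrow> bool" where
  "has_density C r \<longleftrightarrow> (\<lambda>n. initial_density n C) \<longlonglongrightarrow> r"

definition generic_description :: "(nat \<rightharpoonup> nat) \<Rightarrow> (nat \<Rightarrow> nat) \<Rightarrow> bool" where
  "generic_description d g \<longleftrightarrow> (\<forall>n \<in> dom d. d n = Some (g n)) \<and> has_density (dom d) 1"

definition generically_computable :: "(nat \<Rightarrow> nat) \<Rightarrow> bool" where
  "generically_computable g \<longleftrightarrow> (\<exists>d. partial_computable d \<and> generic_description d g)"

definition string_code :: "bool list \<Rightarrow> nat" where
  "string_code s = list_encode (map of_bool s)"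

definition ce_strings_in :: "(nat \<Rightarrow> nat) \<Rightarrow> bool list set \<Rightarrow> bool" where
  "ce_strings_in g S \<longleftrightarrow> ce_in g (string_code ` S)"

definition initial_segment :: "nat set \<Rightarrow> nat \<Rightarrow> bool list" where
  "initial_segment X n = map (\<lambda>i. i \<in> X) [0..<n]"

definition one_generic_in :: "(nat \<Rightarrow> nat) \<Rightarrow> nat set \<Rightarrow> bool" where
  "one_generic_in f X \<longleftrightarrow>
     (\<forall>S. ce_strings_in f S \<longrightarrow>
        (\<exists>n. initial_segment X n \<in> S) \<or>
        (\<exists>n. \<not> (\<exists>t \<in> S. prefix (initial_segment X n) t)))"

text \<open>Finite sets are coded by their canonical indices.\<close>

definition enumeration_operator :: "(nat set \<times> nat) set \<Rightarrow> bool" where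
  "enumeration_operator W \<longleftrightarrow>
     (\<forall>(F, k) \<in> W. finite F) \<and> ce ((\<lambda>(F, k). prod_encode (set_encode F, k)) ` W)"

definition enum_apply :: "(nat set \<times> nat) set \<Rightarrow> nat set \<Rightarrow> nat set" where
  "enum_apply W Y = {k. \<exists>F. (F, k) \<in> W \<and> F \<subseteq> Y}"

definition gra :: "(nat \<rightharpoonup> nat) \<Rightarrow> nat set" where
  "gra d = {prod_encode (n, y) | n y. d n = Some y}"

definition ng_reducible :: "(nat \<Rightarrow> nat) \<Rightarrow> (nat \<Rightarrow> nat) \<Rightarrow> bool" (infix "\<le>\<^sub>n\<^sub>g" 50) where
  "h \<le>\<^sub>n\<^sub>g g \<longleftrightarrow>
     (\<forall>d. generic_description d g \<longrightarrow>
        (\<exists>e W. generic_description e h \<and> enumeration_operator W \<and> gra e = enum_apply W (gra d)))"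

definition ug_reducible :: "(nat \<Rightarrow> nat) \<Rightarrow> (nat \<Rightarrow> nat) \<Rightarrow> bool" (infix "\<le>\<^sub>u\<^sub>g" 50) where
  "h \<le>\<^sub>u\<^sub>g g \<longleftrightarrow>
     (\<exists>W. enumeration_operator W \<and>
        (\<forall>d. generic_description d g \<longrightarrow>
           (\<exists>e. generic_description e h \<and> gra e = enum_apply W (gra d))))"

text \<open>The topology of \<open>2\<^sup>\<omega>\<close>, carried over to subsets of \<open>\<omega>\<close>
  along \<open>X \<mapsto> (\<lambda>n. n \<in> X)\<close>.\<close>

definition cantor_space :: "nat set topology" where
  "cantor_space =
     pullback_topology UNIV (\<lambda>X n. n \<in> X) (product_topology (\<lambda>_. discrete_topology UNIV) UNIV)"

definition nowhere_dense_in :: "'a topology \<Rightarrow> 'a set \<Rightarrow> bool" where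
  "nowhere_dense_in T S \<longleftrightarrow> S \<subseteq> topspace T \<and> T interior_of (T closure_of S) = {}"

definition meager_in :: "'a topology \<Rightarrow> 'a set \<Rightarrow> bool" where
  "meager_in T S \<longleftrightarrow> (\<exists>U :: nat \<Rightarrow> 'a set. (\<forall>i. nowhere_dense_in T (U i)) \<and> S = (\<Union>i. U i))"

end

theory Submission
  imports Defs
begin

text \<open>
  Suppose the machine \<open>p\<close> with oracle \<open>X\<close> computes a generic description of \<open>f\<close>, and let
  \<open>S\<close> be the \<open>f\<close>-c.e. set of strings \<open>s\<close> on which \<open>p\<close> gives an answer that disagrees with
  \<open>f\<close>. No initial segment of \<open>X\<close> lies in \<open>S\<close>, so 1-genericity yields an initial segment
  \<open>s\<close> of \<open>X\<close> without extensions in \<open>S\<close>. Answering \<open>n\<close> by the first convergent computation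
  of \<open>p\<close> on an extension of \<open>s\<close> is then always correct and defined wherever \<open>p\<close> with
  oracle \<open>X\<close> is, so \<open>f\<close> is generically computable.

  The same dichotomy gives meagerness directly. Fix an enumeration operator \<open>W\<close> and a cylinder.
  Either some finite use inside the cylinder makes \<open>W\<close> enumerate a false value of \<open>A\<close>, and a
  smaller cylinder avoids all \<open>X\<close> for which \<open>W\<close> applied to the graph of \<open>X\<close> generically
  describes \<open>A\<close>; or no such use exists, and then the cylinder contains no such \<open>X\<close> at all,
  since otherwise searching over finite sets in the cylinder would compute a generic description
  of \<open>A\<close>. There are only countably many \<open>W\<close>.
\<close>

section \<open>Total recursive functions\<close>

text \<open>Argument lists are kept whole, so that closure rules can be stated for all arities at
  once.\<close>

definition total_recursive :: "(nat \<Rightarrow> nat) \<Rightarrow> nat \<Rightarrow> (nat list \<Rightarrow> nat) \<Rightarrow> bool" where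
  "total_recursive g k F \<longleftrightarrow> (\<exists>p. \<forall>xs. length xs = k \<longrightarrow> run g p xs = Some (F xs))"

definition decidable_in :: "(nat \<Rightarrow> nat) \<Rightarrow> nat \<Rightarrow> (nat list \<Rightarrow> bool) \<Rightarrow> bool" where
  "decidable_in g k P \<longleftrightarrow> total_recursive g k (\<lambda>xs. of_bool (P xs))"

named_theorems recursive_intros

lemma total_recursive_cong:
  assumes "\<And>xs. length xs = k \<Longrightarrow> F xs = G xs" and "total_recursive g k G"
  shows "total_recursive g k F"
  using assms unfolding total_recursive_def by metis

lemma decidable_in_cong:
  assumes "\<And>xs. length xs = k \<Longrightarrow> P xs \<longleftrightarrow> Q xs" and "decidable_in g k Q"
  shows "decidable_in g k P"
  using assms unfolding decidable_in_def
  by (auto intro: total_recursive_cong)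

lemma total_recursive_comp:
  assumes H: "total_recursive g (length Fs) H" and Fs: "\<And>F. F \<in> set Fs \<Longrightarrow> total_recursive g k F"
  shows "total_recursive g k (\<lambda>xs. H (map (\<lambda>F. F xs) Fs))"
proof -
  obtain p where p: "\<And>xs. length xs = length Fs \<Longrightarrow> run g p xs = Some (H xs)"
    using H unfolding total_recursive_def by blast
  obtain q where q: "\<And>F xs. F \<in> set Fs \<Longrightarrow> length xs = k \<Longrightarrow> run g (q F) xs = Some (F xs)"
    using Fs unfolding total_recursive_def by metis
  have "run g (Comp p (map q Fs)) xs = Some (H (map (\<lambda>F. F xs) Fs))" if "length xs = k" for xs
  proof -
    have "map (\<lambda>F. the (run g (q F) xs)) Fs = map (\<lambda>F. F xs) Fs"
      using q that by auto
    then show ?thesis using q that p by (auto simp: comp_def simp del: map_eq_conv)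
  qed
  then show ?thesis unfolding total_recursive_def by blast
qed

lemma total_recursive_proj [recursive_intros]: "i < k \<Longrightarrow> total_recursive g k (\<lambda>xs. xs ! i)"
  unfolding total_recursive_def by (rule exI[of _ "Proj i"]) auto

lemma total_recursive_comp1:
  assumes "total_recursive g 1 (\<lambda>xs. H (xs ! 0))" and "total_recursive g k A"
  shows "total_recursive g k (\<lambda>xs. H (A xs))"
  using total_recursive_comp[of g "[A]" "\<lambda>xs. H (xs ! 0)" k] assms by simp

lemma total_recursive_comp2:
  assumes "total_recursive g 2 (\<lambda>xs. H (xs ! 0) (xs ! 1))"
    and "total_recursive g k A" and "total_recursive g k B"
  shows "total_recursive g k (\<lambda>xs. H (A xs) (B xs))"
  using total_recursive_comp[of g "[A, B]" "\<lambda>xs. H (xs ! 0) (xs ! 1)" k] assms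
  by (auto simp: numeral_2_eq_2)

text \<open>Composition with the projections past position 0. The fresh leading variable will be a
  recursion counter, an accumulator or a summation index.\<close>

lemma total_recursive_tl:
  assumes "total_recursive g k A"
  shows "total_recursive g (Suc k) (\<lambda>ys. A (tl ys))"
proof (rule total_recursive_cong)
  show "total_recursive g (Suc k)
      (\<lambda>ys. A (map (\<lambda>F. F ys) (map (\<lambda>i ys. ys ! Suc i) [0..<k])))"
    using assms by (intro total_recursive_comp) (auto intro: recursive_intros)
  show "A (tl ys) = A (map (\<lambda>F. F ys) (map (\<lambda>i ys. ys ! Suc i) [0..<k]))"
    if "length ys = Suc k" for ys
    using that by (intro arg_cong[where f = A] nth_equalityI) (auto simp: nth_tl)
qed

text \<open>Under the binder of a sum or of a primitive recursion the outer arguments appear as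
  \<open>tl ys\<close> and \<open>tl (tl ys)\<close>; the introduction rules need projections of
  this shape.\<close>

lemma total_recursive_proj_tl [recursive_intros]:
  "Suc i < k \<Longrightarrow> total_recursive g k (\<lambda>ys. tl ys ! i)"
  by (rule total_recursive_cong[OF _ total_recursive_proj[of "Suc i"]]) (auto simp: nth_tl)

lemma total_recursive_proj_tl_tl [recursive_intros]:
  "Suc (Suc i) < k \<Longrightarrow> total_recursive g k (\<lambda>ys. tl (tl ys) ! i)"
  by (rule total_recursive_cong[OF _ total_recursive_proj[of "Suc (Suc i)"]]) (auto simp: nth_tl)

lemma total_recursive_Suc [recursive_intros]:
  "total_recursive g k A \<Longrightarrow> total_recursive g k (\<lambda>xs. Suc (A xs))"
  by (rule total_recursive_comp1[of g Suc])
    (auto simp: total_recursive_def length_Suc_conv intro!: exI[of _ Succ])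

lemma total_recursive_oracle:
  "total_recursive g k A \<Longrightarrow> total_recursive g k (\<lambda>xs. g (A xs))"
  by (rule total_recursive_comp1[of g g])
    (auto simp: total_recursive_def length_Suc_conv intro!: exI[of _ Oracle])

lemma total_recursive_const [recursive_intros]: "total_recursive g k (\<lambda>xs. c)"
proof (induction c)
  case 0
  show ?case unfolding total_recursive_def by (rule exI[of _ Zero]) auto
next
  case (Suc c)
  then show ?case by (rule total_recursive_Suc)
qed

lemma total_recursive_rec_nat:
  assumes N: "total_recursive g k N" and B: "total_recursive g k B"
    and S: "total_recursive g (Suc (Suc k)) (\<lambda>ys. S (ys ! 0) (ys ! 1) (tl (tl ys)))"
  shows "total_recursive g k (\<lambda>xs. rec_nat (B xs) (\<lambda>m r. S m r xs) (N xs))"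
proof -
  obtain b where b: "\<And>xs. length xs = k \<Longrightarrow> run g b xs = Some (B xs)"
    using B unfolding total_recursive_def by blast
  obtain s where s: "\<And>xs. length xs = Suc (Suc k) \<Longrightarrow>
      run g s xs = Some (S (xs ! 0) (xs ! 1) (tl (tl xs)))"
    using S unfolding total_recursive_def by blast
  have "run g (PrimRec b s) (n # xs) = Some (rec_nat (B xs) (\<lambda>m r. S m r xs) n)"
    if "length xs = k" for n xs
    using that b s by (induction n) auto
  then have "total_recursive g (Suc k) (\<lambda>ys. rec_nat (B (tl ys)) (\<lambda>m r. S m r (tl ys)) (ys ! 0))"
    unfolding total_recursive_def by (intro exI[of _ "PrimRec b s"]) (auto simp: length_Suc_conv)
  \<comment> \<open>\<open>PrimRec\<close> recurses on its first argument; composing with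
    \<open>N\<close> followed by all projections puts \<open>N xs\<close> there.\<close>
  then have "total_recursive g k (\<lambda>xs. (\<lambda>ys. rec_nat (B (tl ys)) (\<lambda>m r. S m r (tl ys)) (ys ! 0))
      (map (\<lambda>F. F xs) (N # map (\<lambda>i xs. xs ! i) [0..<k])))"
    using N by (intro total_recursive_comp) (auto intro: recursive_intros)
  then show ?thesis
    by (rule total_recursive_cong[rotated]) (auto simp: comp_def map_nth)
qed

section \<open>Closure under arithmetic and bounded sums\<close>

lemma total_recursive_add [recursive_intros]:
  assumes "total_recursive g k A" and "total_recursive g k B"
  shows "total_recursive g k (\<lambda>xs. A xs + B xs)"
proof -
  have "rec_nat a (\<lambda>_ r. Suc r) b = a + b" for a b by (induction b) auto
  moreover have "total_recursive g k (\<lambda>xs. rec_nat (A xs) (\<lambda>_ r. Suc r) (B xs))"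
    by (intro total_recursive_rec_nat recursive_intros assms assms[THEN total_recursive_tl, THEN total_recursive_tl]) auto
  ultimately show ?thesis by simp
qed

lemma total_recursive_mult [recursive_intros]:
  assumes "total_recursive g k A" and "total_recursive g k B"
  shows "total_recursive g k (\<lambda>xs. A xs * B xs)"
proof -
  have "rec_nat 0 (\<lambda>_ r. r + a) b = a * b" for a b :: nat by (induction b) auto
  moreover have "total_recursive g k (\<lambda>xs. rec_nat 0 (\<lambda>_ r. r + A xs) (B xs))"
    by (intro total_recursive_rec_nat recursive_intros assms assms[THEN total_recursive_tl, THEN total_recursive_tl]) auto
  ultimately show ?thesis by simp
qed

lemma total_recursive_power [recursive_intros]:
  assumes "total_recursive g k A" and "total_recursive g k B"
  shows "total_recursive g k (\<lambda>xs. A xs ^ B xs)"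
proof -
  have "rec_nat 1 (\<lambda>_ r. r * a) b = a ^ b" for a b :: nat by (induction b) auto
  moreover have "total_recursive g k (\<lambda>xs. rec_nat 1 (\<lambda>_ r. r * A xs) (B xs))"
    by (intro total_recursive_rec_nat recursive_intros assms assms[THEN total_recursive_tl, THEN total_recursive_tl]) auto
  ultimately show ?thesis by simp
qed

lemma total_recursive_diff [recursive_intros]:
  assumes "total_recursive g k A" and "total_recursive g k B"
  shows "total_recursive g k (\<lambda>xs. A xs - B xs)"
proof -
  have pred: "total_recursive g l (\<lambda>xs. C xs - 1)" if "total_recursive g l C" for l C
  proof -
    have "rec_nat 0 (\<lambda>m _. m) c = c - 1" for c by (cases c) auto
    moreover have "total_recursive g l (\<lambda>xs. rec_nat 0 (\<lambda>m _. m) (C xs))"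
      by (intro total_recursive_rec_nat recursive_intros that) auto
    ultimately show ?thesis by simp
  qed
  have "rec_nat a (\<lambda>_ r. r - 1) b = a - b" for a b :: nat by (induction b) auto
  moreover have "total_recursive g k (\<lambda>xs. rec_nat (A xs) (\<lambda>_ r. r - 1) (B xs))"
    by (intro total_recursive_rec_nat pred recursive_intros assms assms[THEN total_recursive_tl, THEN total_recursive_tl]) auto
  ultimately show ?thesis by simp
qed

text \<open>Bounded sums serve as bounded search: bounded quantifiers, quotients, pair decoding and
  fuel-bounded minimisation are all obtained below as sums over indicators.\<close>

lemma total_recursive_sum:
  assumes N: "total_recursive g k N"
    and F: "total_recursive g (Suc k) (\<lambda>ys. F (ys ! 0) (tl ys))"
  shows "total_recursive g k (\<lambda>xs. \<Sum>i<N xs. F i xs)"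
proof -
  have "rec_nat 0 (\<lambda>m r. r + h m) n = sum h {..<n}" for h :: "nat \<Rightarrow> nat" and n
    by (induction n) auto
  moreover have "total_recursive g (Suc (Suc k)) (\<lambda>ys. F (ys ! 0) (tl (tl ys)))"
  proof (rule total_recursive_cong)
    \<comment> \<open>The step function of the recursion receives counter, accumulator and
      arguments; these projections skip the accumulator at position 1.\<close>
    show "total_recursive g (Suc (Suc k)) (\<lambda>ys. (\<lambda>zs. F (zs ! 0) (tl zs))
        (map (\<lambda>G. G ys) ((\<lambda>ys. ys ! 0) # map (\<lambda>i ys. tl (tl ys) ! i) [0..<k])))"
      using F by (intro total_recursive_comp) (auto intro!: recursive_intros)
    show "F (ys ! 0) (tl (tl ys)) = (\<lambda>zs. F (zs ! 0) (tl zs))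
        (map (\<lambda>G. G ys) ((\<lambda>ys. ys ! 0) # map (\<lambda>i ys. tl (tl ys) ! i) [0..<k]))"
      if "length ys = Suc (Suc k)" for ys
      using map_nth[of "tl (tl ys)"] that by (simp add: comp_def)
  qed
  then have "total_recursive g k (\<lambda>xs. rec_nat 0 (\<lambda>m r. r + F m xs) (N xs))"
    by (intro total_recursive_rec_nat recursive_intros N) auto
  ultimately show ?thesis by simp
qed

section \<open>Decidable predicates\<close>

lemma total_recursive_of_bool [recursive_intros]:
  "decidable_in g k P \<Longrightarrow> total_recursive g k (\<lambda>xs. of_bool (P xs))"
  by (simp add: decidable_in_def)

lemma decidable_in_const [recursive_intros]: "decidable_in g k (\<lambda>xs. b)"
  unfolding decidable_in_def by (rule total_recursive_const)

lemma decidable_in_not [recursive_intros]: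
  assumes "decidable_in g k P"
  shows "decidable_in g k (\<lambda>xs. \<not> P xs)"
proof -
  have "total_recursive g k (\<lambda>xs. 1 - of_bool (P xs))"
    by (intro recursive_intros assms)
  then show ?thesis
    unfolding decidable_in_def by (rule total_recursive_cong[rotated]) auto
qed

lemma decidable_in_conj [recursive_intros]:
  assumes "decidable_in g k P" and "decidable_in g k Q"
  shows "decidable_in g k (\<lambda>xs. P xs \<and> Q xs)"
proof -
  have "total_recursive g k (\<lambda>xs. of_bool (P xs) * of_bool (Q xs))"
    by (intro recursive_intros assms)
  then show ?thesis
    unfolding decidable_in_def by (rule total_recursive_cong[rotated]) auto
qed

lemma decidable_in_disj [recursive_intros]:
  assumes "decidable_in g k P" and "decidable_in g k Q"
  shows "decidable_in g k (\<lambda>xs. P xs \<or> Q xs)"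
proof -
  have "decidable_in g k (\<lambda>xs. \<not> (\<not> P xs \<and> \<not> Q xs))"
    by (intro recursive_intros assms)
  then show ?thesis by simp
qed

lemma decidable_in_imp [recursive_intros]:
  assumes "decidable_in g k P" and "decidable_in g k Q"
  shows "decidable_in g k (\<lambda>xs. P xs \<longrightarrow> Q xs)"
proof -
  have "decidable_in g k (\<lambda>xs. \<not> P xs \<or> Q xs)"
    by (intro recursive_intros assms)
  then show ?thesis by simp
qed

lemma decidable_in_le [recursive_intros]:
  assumes "total_recursive g k A" and "total_recursive g k B"
  shows "decidable_in g k (\<lambda>xs. A xs \<le> B xs)"
proof -
  have "total_recursive g k (\<lambda>xs. 1 - (A xs - B xs))"
    by (intro recursive_intros assms)
  then show ?thesis
    unfolding decidable_in_def by (rule total_recursive_cong[rotated]) auto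
qed

lemma decidable_in_less [recursive_intros]:
  assumes "total_recursive g k A" and "total_recursive g k B"
  shows "decidable_in g k (\<lambda>xs. A xs < B xs)"
proof -
  have "decidable_in g k (\<lambda>xs. Suc (A xs) \<le> B xs)"
    by (intro recursive_intros assms)
  then show ?thesis by (simp add: Suc_le_eq)
qed

lemma decidable_in_eq [recursive_intros]:
  fixes A B :: "nat list \<Rightarrow> nat"
  assumes "total_recursive g k A" and "total_recursive g k B"
  shows "decidable_in g k (\<lambda>xs. A xs = B xs)"
proof -
  have "decidable_in g k (\<lambda>xs. A xs \<le> B xs \<and> B xs \<le> A xs)"
    by (intro recursive_intros assms)
  then show ?thesis by (rule decidable_in_cong[rotated]) auto
qed

lemma decidable_in_iff [recursive_intros]:
  assumes "decidable_in g k P" and "decidable_in g k Q"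
  shows "decidable_in g k (\<lambda>xs. P xs \<longleftrightarrow> Q xs)"
proof -
  have "decidable_in g k (\<lambda>xs. (P xs \<longrightarrow> Q xs) \<and> (Q xs \<longrightarrow> P xs))"
    by (intro recursive_intros assms)
  then show ?thesis by (rule decidable_in_cong[rotated]) auto
qed

lemma total_recursive_if [recursive_intros]:
  assumes "decidable_in g k P" and "total_recursive g k A" and "total_recursive g k B"
  shows "total_recursive g k (\<lambda>xs. if P xs then A xs else B xs)"
proof -
  have "total_recursive g k (\<lambda>xs. of_bool (P xs) * A xs + of_bool (\<not> P xs) * B xs)"
    by (intro recursive_intros assms)
  then show ?thesis by (rule total_recursive_cong[rotated]) auto
qed

lemma decidable_in_all_less:
  assumes "total_recursive g k N" and "decidable_in g (Suc k) (\<lambda>ys. P (ys ! 0) (tl ys))"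
  shows "decidable_in g k (\<lambda>xs. \<forall>i<N xs. P i xs)"
proof -
  have "decidable_in g k (\<lambda>xs. (\<Sum>i<N xs. of_bool (\<not> P i xs)) = (0::nat))"
    by (intro recursive_intros total_recursive_sum assms)
  then show ?thesis by (rule decidable_in_cong[rotated]) auto
qed

lemma decidable_in_ball_list:
  assumes "\<And>q. q \<in> set qs \<Longrightarrow> decidable_in g k (P q)"
  shows "decidable_in g k (\<lambda>xs. \<forall>q\<in>set qs. P q xs)"
  using assms
proof (induction qs)
  case (Cons q qs)
  then have "decidable_in g k (\<lambda>xs. P q xs \<and> (\<forall>q\<in>set qs. P q xs))"
    by (intro recursive_intros) auto
  then show ?case by simp
qed (simp add: decidable_in_const)

section \<open>Decoding pairs, lists and finite sets\<close>

lemma total_recursive_div [recursive_intros]: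
  assumes "total_recursive g k A" and "total_recursive g k B"
  shows "total_recursive g k (\<lambda>xs. A xs div B xs)"
proof (rule total_recursive_comp2[OF _ assms])
  \<comment> \<open>The quotient is the only \<open>m\<close> that passes the test, and it is at
    most \<open>a\<close>. For \<open>b = 0\<close> nothing passes and the empty sum agrees with
    \<open>a div 0 = 0\<close>.\<close>
  have eq: "a div b = (\<Sum>m<Suc a. m * of_bool (m * b \<le> a \<and> a < Suc m * b))" for a b :: nat
  proof (cases "b = 0")
    case False
    have "m * b \<le> a \<and> a < Suc m * b \<longleftrightarrow> m = a div b" for m
    proof
      assume "m * b \<le> a \<and> a < Suc m * b"
      then show "m = a div b" by (intro div_nat_eqI[symmetric]) (auto simp: algebra_simps)
    next
      assume "m = a div b"
      then show "m * b \<le> a \<and> a < Suc m * b"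
        using False dividend_less_div_times[of b a] by (auto simp: algebra_simps)
    qed
    then have "(\<Sum>m<Suc a. m * of_bool (m * b \<le> a \<and> a < Suc m * b))
        = (\<Sum>m<Suc a. if m = a div b then a div b else 0)"
      by (intro sum.cong) auto
    also have "\<dots> = a div b" by (subst sum.delta) (auto simp: less_Suc_eq_le)
    finally show ?thesis by simp
  qed simp
  show "total_recursive g 2 (\<lambda>xs. xs ! 0 div xs ! 1)"
    unfolding eq by (intro recursive_intros total_recursive_sum) (auto intro!: recursive_intros)
qed

lemma decidable_in_odd [recursive_intros]:
  assumes "total_recursive g k A"
  shows "decidable_in g k (\<lambda>xs. odd (A xs))"
proof -
  have "decidable_in g k (\<lambda>xs. A xs - 2 * (A xs div 2) = 1)"
    by (intro recursive_intros assms)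
  then show ?thesis
    by (rule decidable_in_cong[rotated]) (auto simp: minus_mult_div_eq_mod odd_iff_mod_2_eq_one)
qed

lemma decidable_in_set_decode [recursive_intros]:
  assumes "total_recursive g k A" and "total_recursive g k B"
  shows "decidable_in g k (\<lambda>xs. A xs \<in> set_decode (B xs))"
  unfolding set_decode_def mem_Collect_eq by (intro recursive_intros assms)

lemma total_recursive_prod_encode [recursive_intros]:
  assumes "total_recursive g k A" and "total_recursive g k B"
  shows "total_recursive g k (\<lambda>xs. prod_encode (A xs, B xs))"
  unfolding prod_encode_def triangle_def by (simp, intro recursive_intros assms)

text \<open>Both components of a pair are bounded by its code, so exactly one term of the double sum
  survives. Taking \<open>h\<close> to be a projection makes decoding a bounded sum.\<close>

lemma sum_prod_encode:
  fixes h :: "nat \<Rightarrow> nat \<Rightarrow> nat"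
  shows "(\<Sum>m<Suc z. \<Sum>n<Suc z. h m n * of_bool (prod_encode (m, n) = z))
    = h (fst (prod_decode z)) (snd (prod_decode z))"
proof -
  obtain a b where ab: "prod_decode z = (a, b)" by force
  then have z: "z = prod_encode (a, b)" by (metis prod_decode_inverse)
  have "(\<Sum>m<Suc z. \<Sum>n<Suc z. h m n * of_bool (prod_encode (m, n) = z))
      = (\<Sum>m<Suc z. \<Sum>n<Suc z. if n = b then (if m = a then h a b else 0) else 0)"
    by (intro sum.cong refl) (auto simp: z prod_encode_eq)
  also have "\<dots> = h a b"
    using le_prod_encode_1[of a b] le_prod_encode_2[of b a]
    by (subst sum.delta, simp)+ (auto simp: z)
  finally show ?thesis by (simp add: ab)
qed

lemma total_recursive_fst_prod_decode [recursive_intros]: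
  assumes "total_recursive g k A"
  shows "total_recursive g k (\<lambda>xs. fst (prod_decode (A xs)))"
proof (rule total_recursive_comp1[OF _ assms])
  show "total_recursive g 1 (\<lambda>xs. fst (prod_decode (xs ! 0)))"
    unfolding sum_prod_encode[of "\<lambda>m n. m", symmetric]
    by (intro recursive_intros total_recursive_sum) (auto intro!: recursive_intros)
qed

lemma total_recursive_snd_prod_decode [recursive_intros]:
  assumes "total_recursive g k A"
  shows "total_recursive g k (\<lambda>xs. snd (prod_decode (A xs)))"
proof (rule total_recursive_comp1[OF _ assms])
  show "total_recursive g 1 (\<lambda>xs. snd (prod_decode (xs ! 0)))"
    unfolding sum_prod_encode[of "\<lambda>m n. n", symmetric]
    by (intro recursive_intros total_recursive_sum) (auto intro!: recursive_intros)
qed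

text \<open>A nonempty list has code \<open>Suc (prod_encode (head, code of tail))\<close>, so one
  step of the recursion takes the tail. The empty list stays fixed, since \<open>0 - 1 = 0\<close>
  and \<open>prod_decode 0 = (0, 0)\<close>.\<close>

definition code_drop :: "nat \<Rightarrow> nat \<Rightarrow> nat" where
  "code_drop c i = rec_nat c (\<lambda>_ r. snd (prod_decode (r - 1))) i"

text \<open>Serves as the finite partial oracle given by a coded string.\<close>

definition list_lookup :: "nat \<Rightarrow> nat \<Rightarrow> nat option" where
  "list_lookup c i =
     (if i < length (list_decode c) then Some (list_decode c ! i) else None)"

text \<open>Turns partial results into numbers, with 0 reserved for divergence, so that
  recursiveness can be claimed of a total function.\<close>

definition option_code :: "nat option \<Rightarrow> nat" where
  "option_code z = (case z of None \<Rightarrow> 0 | Some v \<Rightarrow> Suc v)"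

lemma option_code_simps [simp]:
  "option_code None = 0" "option_code (Some v) = Suc v"
  by (simp_all add: option_code_def)

lemma option_code_eq_0_iff [simp]: "option_code z = 0 \<longleftrightarrow> z = None"
  by (cases z) auto

lemma list_decode_code_drop: "list_decode (code_drop c i) = drop i (list_decode c)"
proof (induction i)
  case (Suc i)
  have "list_decode (snd (prod_decode (r - 1))) = tl (list_decode r)" for r
  proof (cases r)
    case 0
    have "prod_decode 0 = (0, 0)"
      by (simp add: prod_decode_def prod_decode_aux.simps)
    with 0 show ?thesis by simp
  qed (auto split: prod.splits)
  then have "list_decode (code_drop c (Suc i)) = tl (list_decode (code_drop c i))"
    by (simp add: code_drop_def)
  then show ?case by (simp only: Suc tl_drop drop_Suc)
qed (simp add: code_drop_def)

lemma option_code_list_lookup: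
  "option_code (list_lookup c i) =
     (if code_drop c i = 0 then 0 else Suc (fst (prod_decode (code_drop c i - 1))))"
proof (cases "code_drop c i")
  case 0
  then show ?thesis using list_decode_code_drop[of c i] by (simp add: list_lookup_def)
next
  case (Suc d)
  obtain a b where ab: "prod_decode d = (a, b)" by force
  then have *: "drop i (list_decode c) = a # list_decode b"
    using Suc list_decode_code_drop[of c i] by simp
  then have "i < length (list_decode c)"
    by (metis drop_eq_Nil2 leI list.distinct(1))
  moreover have "list_decode c ! i = a"
    using * calculation by (metis hd_drop_conv_nth list.sel(1))
  ultimately show ?thesis using Suc ab by (simp add: list_lookup_def)
qed

lemma total_recursive_list_lookup [recursive_intros]:
  assumes "total_recursive g k A" and "total_recursive g k B"
  shows "total_recursive g k (\<lambda>xs. option_code (list_lookup (A xs) (B xs)))"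
proof -
  have "total_recursive g k (\<lambda>xs. code_drop (A xs) (B xs))"
    unfolding code_drop_def
    by (intro total_recursive_rec_nat recursive_intros assms) auto
  then show ?thesis unfolding option_code_list_lookup by (intro recursive_intros)
qed

lemma length_le_list_encode: "length l \<le> list_encode l"
proof (induction l)
  case (Cons x l)
  then show ?case using le_prod_encode_2[of "list_encode l" x] by simp
qed simp

lemma decidable_in_binary_list [recursive_intros]:
  assumes "total_recursive g k A"
  shows "decidable_in g k (\<lambda>xs. \<forall>x\<in>set (list_decode (A xs)). x \<le> 1)"
proof -
  \<comment> \<open>The code bounds the length of its list. The bound 2 is 1 shifted by
    \<open>option_code\<close>; positions past the end give 0 and pass.\<close>
  have "(\<forall>x\<in>set (list_decode c). x \<le> 1) \<longleftrightarrow> (\<forall>i<c. option_code (list_lookup c i) \<le> 2)" for c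
    using length_le_list_encode[of "list_decode c"]
    by (auto simp: list_lookup_def all_set_conv_all_nth)
  then show ?thesis
    by (simp only:)
      (intro decidable_in_all_less recursive_intros assms total_recursive_tl[OF assms]; simp)
qed

section \<open>Fuel-bounded evaluation with a partial oracle\<close>

text \<open>The fuel \<open>t\<close> only bounds minimisation; this alone makes evaluation total recursive in
  \<open>t\<close>, in a code of the oracle \<open>\<phi>\<close> and in the arguments, for each fixed program.\<close>

fun bounded_run :: "(nat \<rightharpoonup> nat) \<Rightarrow> nat \<Rightarrow> recfn \<Rightarrow> nat list \<Rightarrow> nat option" where
  "bounded_run \<phi> t Zero xs = Some 0"
| "bounded_run \<phi> t Succ xs = (case xs of [x] \<Rightarrow> Some (Suc x) | _ \<Rightarrow> None)"
| "bounded_run \<phi> t Oracle xs = (case xs of [x] \<Rightarrow> \<phi> x | _ \<Rightarrow> None)"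
| "bounded_run \<phi> t (Proj i) xs = (if i < length xs then Some (xs ! i) else None)"
| "bounded_run \<phi> t (Comp p qs) xs =
     (if \<forall>q \<in> set qs. bounded_run \<phi> t q xs \<noteq> None
      then bounded_run \<phi> t p (map (\<lambda>q. the (bounded_run \<phi> t q xs)) qs) else None)"
| "bounded_run \<phi> t (PrimRec b s) xs =
     (case xs of
        [] \<Rightarrow> None
      | n # ys \<Rightarrow>
          rec_nat (bounded_run \<phi> t b ys)
            (\<lambda>m r. case r of None \<Rightarrow> None | Some v \<Rightarrow> bounded_run \<phi> t s (m # v # ys)) n)"
| "bounded_run \<phi> t (Minim p) xs =
     (if \<exists>n<t. bounded_run \<phi> t p (n # xs) = Some 0 \<and>
               (\<forall>m<n. \<exists>v. bounded_run \<phi> t p (m # xs) = Some (Suc v))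
      then Some (LEAST n. bounded_run \<phi> t p (n # xs) = Some 0) else None)"

text \<open>The semantics of \<open>Minim\<close> tests for a zero preceded by defined positive
  values but returns a \<open>LEAST\<close> zero; this identifies the two.\<close>

lemma Least_first_zero:
  fixes h :: "nat \<Rightarrow> nat option"
  assumes "h n = Some 0" and "\<forall>m<n. \<exists>v. h m = Some (Suc v)"
  shows "(LEAST n. h n = Some 0) = n"
proof (rule Least_equality)
  fix y assume "h y = Some 0"
  then show "n \<le> y" using assms(2) by (metis leI nat.distinct(1) option.inject)
qed (fact assms(1))

text \<open>A query outside the domain of the partial oracle makes the evaluation undefined, so a
  defined result rests on correct answers only. Minimisation carries over because a bounded success
  exhibits the zero together with all earlier values.\<close>

lemma bounded_run_sound:
  assumes "bounded_run \<phi> t p xs = Some y" and \<phi>: "\<And>x v. \<phi> x = Some v \<Longrightarrow> g x = v"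
  shows "run g p xs = Some y"
  using assms(1)
proof (induction p arbitrary: xs y)
  case (Comp p qs)
  have *: "run g q xs = Some (the (bounded_run \<phi> t q xs))" if "q \<in> set qs" for q
    using Comp that by (auto split: if_splits)
  then have "map (\<lambda>q. the (run g q xs)) qs = map (\<lambda>q. the (bounded_run \<phi> t q xs)) qs"
    by auto
  then show ?case using Comp * by (auto split: if_splits simp del: map_eq_conv)
next
  case (PrimRec b s)
  obtain n ys where xs: "xs = n # ys" using PrimRec.prems by (cases xs) auto
  have "bounded_run \<phi> t (PrimRec b s) (n # ys) = Some y \<Longrightarrow> run g (PrimRec b s) (n # ys) = Some y"
  proof (induction n arbitrary: y)
    case 0
    then show ?case using PrimRec.IH by simp
  next
    case (Suc n)
    then obtain v where "bounded_run \<phi> t (PrimRec b s) (n # ys) = Some v"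
      "bounded_run \<phi> t s (n # v # ys) = Some y"
      by (auto split: option.splits)
    then have "run g (PrimRec b s) (n # ys) = Some v" "run g s (n # v # ys) = Some y"
      using Suc.IH PrimRec.IH by blast+
    then show ?case by simp
  qed
  then show ?case using xs PrimRec.prems by simp
next
  case (Minim p)
  then obtain n where n: "bounded_run \<phi> t p (n # xs) = Some 0"
      "\<forall>m<n. \<exists>v. bounded_run \<phi> t p (m # xs) = Some (Suc v)"
    by (auto split: if_splits)
  then have y: "y = n" using Minim.prems Least_first_zero[OF n] by (auto split: if_splits)
  have r: "run g p (n # xs) = Some 0" "\<forall>m<n. \<exists>v. run g p (m # xs) = Some (Suc v)"
    using n Minim.IH by blast+
  then show ?case using Least_first_zero[OF r] y by auto
qed (auto split: list.splits if_splits dest: \<phi>)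

text \<open>A halting computation has finitely many subcomputations, queries and searches. Each is
  eventually reproduced, and finitely many eventual conditions hold simultaneously.\<close>

lemma bounded_run_complete:
  fixes \<phi> :: "nat \<Rightarrow> nat \<rightharpoonup> nat"
  assumes "run g p xs = Some y"
    and \<phi>: "\<And>x. \<forall>\<^sub>F M in sequentially. \<phi> M x = Some (g x)"
    and t: "\<And>n. \<forall>\<^sub>F M in sequentially. n < t M"
  shows "\<forall>\<^sub>F M in sequentially. bounded_run (\<phi> M) (t M) p xs = Some y"
  using assms(1)
proof (induction p arbitrary: xs y)
  case Oracle
  then obtain x where "xs = [x]" "y = g x" by (auto split: list.splits)
  then show ?case using \<phi> by simp
next
  case (Comp p qs)
  define zs where "zs = map (\<lambda>q. the (run g q xs)) qs"
  have q: "run g q xs = Some (the (run g q xs))" if "q \<in> set qs" for q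
    using Comp that by (auto split: if_splits)
  have p: "run g p zs = Some y" using Comp.prems by (auto split: if_splits simp: zs_def)
  have "\<forall>\<^sub>F M in sequentially. \<forall>q\<in>set qs. bounded_run (\<phi> M) (t M) q xs = Some (the (run g q xs))"
    by (intro eventually_ball_finite ballI Comp.IH(2)[OF _ q]) auto
  moreover have "\<forall>\<^sub>F M in sequentially. bounded_run (\<phi> M) (t M) p zs = Some y"
    using Comp.IH(1) p by blast
  ultimately show ?case
  proof eventually_elim
    case (elim M)
    then have "map (\<lambda>q. the (bounded_run (\<phi> M) (t M) q xs)) qs = zs"
      by (auto simp: zs_def)
    then show ?case using elim by (auto simp del: map_eq_conv)
  qed
next
  case (PrimRec b s)
  obtain n ys where xs: "xs = n # ys" using PrimRec.prems by (cases xs) auto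
  have "run g (PrimRec b s) (n # ys) = Some y \<Longrightarrow>
      \<forall>\<^sub>F M in sequentially. bounded_run (\<phi> M) (t M) (PrimRec b s) (n # ys) = Some y"
  proof (induction n arbitrary: y)
    case 0
    then show ?case using PrimRec.IH by simp
  next
    case (Suc n)
    then obtain v where v: "run g (PrimRec b s) (n # ys) = Some v" "run g s (n # v # ys) = Some y"
      by (auto split: option.splits)
    show ?case
      using Suc.IH[OF v(1)] PrimRec.IH(2)[OF v(2)] by eventually_elim simp
  qed
  then show ?case using xs PrimRec.prems by simp
next
  case (Minim p)
  then obtain n where n: "run g p (n # xs) = Some 0"
      "\<forall>m<n. \<exists>v. run g p (m # xs) = Some (Suc v)"
    by (auto split: if_splits)
  then have y: "y = n" using Minim.prems Least_first_zero[OF n] by (auto split: if_splits)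
  obtain w where w: "\<And>m. m < n \<Longrightarrow> run g p (m # xs) = Some (Suc (w m))"
    using n(2) by metis
  have "\<forall>\<^sub>F M in sequentially. \<forall>m\<in>{..<n}. bounded_run (\<phi> M) (t M) p (m # xs) = Some (Suc (w m))"
    using Minim.IH w by (intro eventually_ball_finite) auto
  moreover have "\<forall>\<^sub>F M in sequentially. bounded_run (\<phi> M) (t M) p (n # xs) = Some 0"
    using Minim.IH n by blast
  ultimately show ?case using t[of n]
  proof eventually_elim
    case (elim M)
    then have r: "bounded_run (\<phi> M) (t M) p (n # xs) = Some 0"
        "\<forall>m<n. \<exists>v. bounded_run (\<phi> M) (t M) p (m # xs) = Some (Suc v)"
      by auto
    then show ?case using Least_first_zero[OF r] y elim by auto
  qed
qed (auto split: list.splits if_splits)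

text \<open>The arguments are substituted into the claim (through \<open>C\<close>, \<open>T\<close> and \<open>As\<close>) because
  the induction on \<open>p\<close> changes the arity.\<close>

lemma total_recursive_bounded_run:
  assumes \<phi>: "\<And>k C A. total_recursive g k C \<Longrightarrow> total_recursive g k A \<Longrightarrow>
      total_recursive g k (\<lambda>xs. option_code (\<phi> (C xs) (A xs)))"
    and "total_recursive g k C" and "total_recursive g k T"
    and "\<And>A. A \<in> set As \<Longrightarrow> total_recursive g k A"
  shows "total_recursive g k
    (\<lambda>xs. option_code (bounded_run (\<phi> (C xs)) (T xs) p (map (\<lambda>A. A xs) As)))"
  using assms(2-)
proof (induction p arbitrary: k C T As)
  case Zero
  then show ?case by (auto intro: recursive_intros)
next
  case Succ
  then consider "As = []" | A where "As = [A]" "total_recursive g k A" | A B Bs where "As = A # B # Bs"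
    by (metis list.exhaust list.set_intros(1))
  then show ?case by cases (simp_all add: total_recursive_const total_recursive_Suc)
next
  case Oracle
  then consider "As = []" | A where "As = [A]" "total_recursive g k A" | A B Bs where "As = A # B # Bs"
    by (metis list.exhaust list.set_intros(1))
  then show ?case by cases (simp_all add: total_recursive_const \<phi> Oracle)
next
  case (Proj i)
  then show ?case by (cases "i < length As") (auto intro!: recursive_intros)
next
  case (Comp p qs)
  define Q where "Q q xs = option_code (bounded_run (\<phi> (C xs)) (T xs) q (map (\<lambda>A. A xs) As))" for q xs
  have Q: "total_recursive g k (Q q)" if "q \<in> set qs" for q
    unfolding Q_def using Comp.IH(2)[OF that] Comp.prems by blast
  \<comment> \<open>Subtracting 1 recovers the value when it is defined. For a divergent argument it
    yields a spurious 0, which the guard in the conditional below discards.\<close>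
  define Bs where "Bs = map (\<lambda>q xs. Q q xs - 1) qs"
  have "total_recursive g k
      (\<lambda>xs. option_code (bounded_run (\<phi> (C xs)) (T xs) p (map (\<lambda>A. A xs) Bs)))"
    using Q by (intro Comp.IH(1) Comp.prems(1,2)) (auto simp: Bs_def intro!: recursive_intros)
  then have "total_recursive g k (\<lambda>xs. if \<forall>q\<in>set qs. Q q xs \<noteq> 0
      then option_code (bounded_run (\<phi> (C xs)) (T xs) p (map (\<lambda>A. A xs) Bs)) else 0)"
    by (intro decidable_in_ball_list recursive_intros Q)
  moreover have "map (\<lambda>A. A xs) Bs =
      map (\<lambda>q. the (bounded_run (\<phi> (C xs)) (T xs) q (map (\<lambda>A. A xs) As))) qs"
    if "\<forall>q\<in>set qs. Q q xs \<noteq> 0" for xs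
    using that by (auto simp: Bs_def Q_def)
  ultimately show ?case
    by (elim total_recursive_cong[rotated]) (auto simp: Q_def simp del: map_map map_eq_conv)
next
  case (PrimRec b s)
  show ?case
  proof (cases As)
    case Nil
    then show ?thesis by (simp add: total_recursive_const)
  next
    case (Cons N Ys)
    \<comment> \<open>The recursion step on codes: \<open>r = 0\<close> propagates divergence, and
      otherwise \<open>r - 1\<close> is the previous value.\<close>
    define R where "R m r xs = (if r = 0 then 0 else
        option_code (bounded_run (\<phi> (C xs)) (T xs) s (m # (r - 1) # map (\<lambda>A. A xs) Ys)))"
      for m r xs
    define Bs where
      "Bs = (\<lambda>ys. ys ! 0) # (\<lambda>ys. ys ! 1 - 1) # map (\<lambda>Y ys. Y (tl (tl ys))) Ys"
    have "total_recursive g (Suc (Suc k)) A" if "A \<in> set Bs" for A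
    proof -
      from that consider "A = (\<lambda>ys. ys ! 0)" | "A = (\<lambda>ys. ys ! 1 - 1)"
        | Y where "Y \<in> set Ys" "A = (\<lambda>ys. Y (tl (tl ys)))"
        unfolding Bs_def by auto
      then show ?thesis
      proof cases
        case 3
        then have "total_recursive g k Y" using PrimRec.prems(3) Cons by simp
        from this[THEN total_recursive_tl, THEN total_recursive_tl] 3 show ?thesis by simp
      qed (simp_all, (intro recursive_intros; simp)+)
    qed
    then have "total_recursive g (Suc (Suc k))
      (\<lambda>ys. option_code (bounded_run (\<phi> (C (tl (tl ys)))) (T (tl (tl ys))) s (map (\<lambda>A. A ys) Bs)))"
      by (rule PrimRec.IH(2)[OF PrimRec.prems(1,2)[THEN total_recursive_tl, THEN total_recursive_tl]])
    then have "total_recursive g (Suc (Suc k)) (\<lambda>ys. R (ys ! 0) (ys ! 1) (tl (tl ys)))"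
      unfolding R_def Bs_def by (intro recursive_intros) (simp_all add: comp_def)
    then have "total_recursive g k (\<lambda>xs. rec_nat
        (option_code (bounded_run (\<phi> (C xs)) (T xs) b (map (\<lambda>A. A xs) Ys)))
        (\<lambda>m r. R m r xs) (N xs))"
      using PrimRec.prems Cons by (intro total_recursive_rec_nat PrimRec.IH) auto
    moreover have "option_code (bounded_run (\<phi> (C xs)) (T xs) (PrimRec b s) (n # map (\<lambda>A. A xs) Ys))
        = rec_nat (option_code (bounded_run (\<phi> (C xs)) (T xs) b (map (\<lambda>A. A xs) Ys)))
            (\<lambda>m r. R m r xs) n" for n xs
    proof (induction n)
      case (Suc n)
      show ?case
        by (simp add: Suc.IH[symmetric]) (simp add: R_def split: option.split)
    qed simp
    ultimately show ?thesis using Cons by simp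
  qed
next
  case (Minim p)
  define E where "E n xs = option_code (bounded_run (\<phi> (C xs)) (T xs) p (n # map (\<lambda>A. A xs) As))"
    for n xs
  \<comment> \<open>Code 1 is the value 0 and codes from 2 on are positive values, so this says that
    the search stops at \<open>n\<close>.\<close>
  define Z where "Z n xs \<longleftrightarrow> E n xs = 1 \<and> (\<forall>m<n. 2 \<le> E m xs)" for n xs
  \<comment> \<open>\<open>D\<close> strips the bound variables in front of the arguments: one for
    the sum over \<open>n\<close>, and a second one for the quantifier over
    \<open>m\<close>.\<close>
  have E: "total_recursive g l (\<lambda>ys. E (ys ! 0) (D ys))"
    if D: "\<And>A. total_recursive g k A \<Longrightarrow> total_recursive g l (\<lambda>ys. A (D ys))" and l: "0 < l" for l D
  proof -
    define Bs where "Bs = (\<lambda>ys. ys ! 0) # map (\<lambda>A ys. A (D ys)) As"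
    have "total_recursive g l B" if "B \<in> set Bs" for B
    proof -
      from that consider "B = (\<lambda>ys. ys ! 0)" | A where "A \<in> set As" "B = (\<lambda>ys. A (D ys))"
        unfolding Bs_def by auto
      then show ?thesis
      proof cases
        case 2
        then show ?thesis using D[OF Minim.prems(3), of A] by simp
      qed (simp add: total_recursive_proj l)
    qed
    then have "total_recursive g l (\<lambda>ys. option_code (bounded_run (\<phi> (C (D ys))) (T (D ys)) p
        (map (\<lambda>A. A ys) Bs)))"
      by (rule Minim.IH[OF D[OF Minim.prems(1)] D[OF Minim.prems(2)]])
    then show ?thesis by (simp add: E_def Bs_def comp_def)
  qed
  have E1: "total_recursive g (Suc k) (\<lambda>ys. E (ys ! 0) (tl ys))"
    by (rule E, erule total_recursive_tl, simp)
  have E2: "total_recursive g (Suc (Suc k)) (\<lambda>ys. E (ys ! 0) (tl (tl ys)))"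
    by (rule E, drule total_recursive_tl, erule total_recursive_tl, simp)
  \<comment> \<open>At most one \<open>n\<close> satisfies \<open>Z\<close>, so the sum is the code
    \<open>Suc n\<close> of a successful search and 0 if there is none.\<close>
  have "total_recursive g k (\<lambda>xs. \<Sum>n<T xs. Suc n * of_bool (Z n xs))"
    unfolding Z_def
    by (intro total_recursive_sum Minim.prems recursive_intros decidable_in_all_less E1 E2) auto
  moreover have "option_code (bounded_run (\<phi> (C xs)) (T xs) (Minim p) (map (\<lambda>A. A xs) As))
      = (\<Sum>n<T xs. Suc n * of_bool (Z n xs))" for xs
  proof -
    let ?h = "\<lambda>n. bounded_run (\<phi> (C xs)) (T xs) p (n # map (\<lambda>A. A xs) As)"
    have one: "option_code z = 1 \<longleftrightarrow> z = Some 0" for z by (cases z) auto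
    have two: "2 \<le> option_code z \<longleftrightarrow> (\<exists>v. z = Some (Suc v))" for z
      by (cases z) (auto simp: numeral_2_eq_2 Suc_le_eq gr0_conv_Suc)
    have Z: "Z n xs \<longleftrightarrow> ?h n = Some 0 \<and> (\<forall>m<n. \<exists>v. ?h m = Some (Suc v))" for n
      unfolding Z_def E_def one two ..
    have eq: "bounded_run (\<phi> (C xs)) (T xs) (Minim p) (map (\<lambda>A. A xs) As)
        = (if \<exists>n<T xs. Z n xs then Some (LEAST n. ?h n = Some 0) else None)"
      by (simp add: Z)
    show ?thesis
    proof (cases "\<exists>n<T xs. Z n xs")
      case True
      then obtain n where n: "n < T xs" "Z n xs" by blast
      have least: "(LEAST n. ?h n = Some 0) = m" if "Z m xs" for m
        using that unfolding Z by (intro Least_first_zero) auto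
      have "(\<Sum>n<T xs. Suc n * of_bool (Z n xs)) = (\<Sum>m<T xs. if m = n then Suc n else 0)"
        using n least by (intro sum.cong) auto
      also have "\<dots> = Suc n" using n by (subst sum.delta) auto
      finally show ?thesis using n least[OF n(2)] True eq by simp
    next
      case False
      then have "(\<Sum>n<T xs. Suc n * of_bool (Z n xs)) = 0" by auto
      then show ?thesis using False eq by simp
    qed
  qed
  ultimately show ?case by simp
qed

text \<open>Minimise the indicator of the negation of \<open>P\<close>, then evaluate
  \<open>V\<close> at the witness. The indicator is total, so the search never gets stuck before the
  least witness.\<close>

lemma partial_computable_in_search:
  assumes P: "decidable_in g 2 (\<lambda>xs. P (xs ! 0) (xs ! 1))"
    and V: "total_recursive g 2 (\<lambda>xs. V (xs ! 0) (xs ! 1))"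
  shows "partial_computable_in g
    (\<lambda>n. if \<exists>w. P w n then Some (V (LEAST w. P w n) n) else None)"
proof -
  have "total_recursive g 2 (\<lambda>xs. of_bool (\<not> P (xs ! 0) (xs ! 1)))"
    by (intro recursive_intros P)
  then obtain q where "\<forall>xs. length xs = 2 \<longrightarrow> run g q xs = Some (of_bool (\<not> P (xs ! 0) (xs ! 1)))"
    unfolding total_recursive_def by blast
  then have q: "run g q [w, n] = Some (of_bool (\<not> P w n))" for w n by simp
  obtain v where "\<forall>xs. length xs = 2 \<longrightarrow> run g v xs = Some (V (xs ! 0) (xs ! 1))"
    using V unfolding total_recursive_def by blast
  then have v: "run g v [w, n] = Some (V w n)" for w n by simp
  have "run g (Minim q) [n] = (if \<exists>w. P w n then Some (LEAST w. P w n) else None)" for n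
  proof -
    have "(\<exists>w. P w n \<and> (\<forall>m<w. \<not> P m n)) \<longleftrightarrow> (\<exists>w. P w n)"
      using exists_least_iff[of "\<lambda>w. P w n"] by blast
    moreover have "(of_bool b = (0::nat)) = (\<not> b)" "(\<exists>v. of_bool b = Suc v) = b" for b
      by (cases b; simp)+
    ultimately show ?thesis by (simp only: run.simps q option.inject not_not)
  qed
  then have "run g (Comp v [Minim q, Proj 0]) [n] =
      (if \<exists>w. P w n then Some (V (LEAST w. P w n) n) else None)" for n
    by (simp add: v del: run.simps(7))
  then show ?thesis unfolding partial_computable_in_def by metis
qed

section \<open>Density\<close>

lemma has_density_mono:
  assumes "has_density C 1" and "C \<subseteq> D"
  shows "has_density D 1"
  unfolding has_density_def
proof (rule tendsto_sandwich[where h = "\<lambda>_. 1"])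
  show "(\<lambda>n. initial_density n C) \<longlonglongrightarrow> 1"
    using assms(1) by (simp add: has_density_def)
  have "card (C \<inter> {..<n}) \<le> card (D \<inter> {..<n})" for n
    using assms(2) by (intro card_mono) auto
  then show "\<forall>\<^sub>F n in sequentially. initial_density n C \<le> initial_density n D"
    by (simp add: initial_density_def divide_right_mono)
  have "card (D \<inter> {..<n}) \<le> n" for n
    using card_mono[of "{..<n}" "D \<inter> {..<n}"] by simp
  then have "initial_density n D \<le> 1" for n
    by (cases "n = 0") (simp_all add: initial_density_def)
  then show "\<forall>\<^sub>F n in sequentially. initial_density n D \<le> 1"
    by simp
qed simp

text \<open>Later, reductions are applied to this description. Its initial densities are 1 only from
  \<open>n = 1\<close> on, because \<open>0 / 0 = 0\<close>.\<close>

lemma generic_description_total: "generic_description (\<lambda>n. Some (g n)) g"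
proof -
  have "\<forall>\<^sub>F n in sequentially. initial_density n UNIV = 1"
    by (rule eventually_sequentiallyI[of 1]) (simp add: initial_density_def)
  then have "has_density UNIV 1"
    unfolding has_density_def by (rule tendsto_eventually)
  then show ?thesis by (simp add: generic_description_def dom_def)
qed

text \<open>The common end of both arguments. Every witness gives the right value, so the least one
  does too. The possibly noncomputable \<open>e\<close> only certifies density: the search succeeds
  on its domain.\<close>

lemma generically_computable_if_search:
  assumes "generic_description e f"
    and "decidable_in (\<lambda>_. 0) 2 (\<lambda>xs. P (xs ! 0) (xs ! 1))"
    and "total_recursive (\<lambda>_. 0) 2 (\<lambda>xs. V (xs ! 0) (xs ! 1))"
    and correct: "\<And>w n. P w n \<Longrightarrow> V w n = f n"
    and total: "\<And>n. n \<in> dom e \<Longrightarrow> \<exists>w. P w n"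
  shows "generically_computable f"
proof -
  define d where "d n = (if \<exists>w. P w n then Some (V (LEAST w. P w n) n) else None)" for n
  have "partial_computable d"
    unfolding partial_computable_def d_def using assms(2,3) by (rule partial_computable_in_search)
  moreover have "d n = Some (f n)" if "n \<in> dom d" for n
    using that correct[OF LeastI_ex[of "\<lambda>w. P w n"]] by (auto simp: d_def split: if_splits)
  moreover have "dom e \<subseteq> dom d" using total by (auto simp: d_def dom_def)
  then have "has_density (dom d) 1"
    using assms(1) by (auto simp: generic_description_def intro: has_density_mono)
  ultimately show ?thesis
    unfolding generically_computable_def generic_description_def by blast
qed

section \<open>Oracles that are 1-generic\<close>

text \<open>Concatenation with a fixed string, done on codes. For each \<open>s\<close> it unfolds
  to finitely many applications of pairing and successor, hence is recursive in
  \<open>c\<close>.\<close>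

fun append_code :: "bool list \<Rightarrow> nat \<Rightarrow> nat" where
  "append_code [] c = c"
| "append_code (b # s) c = Suc (prod_encode (of_bool b, append_code s c))"

lemma append_code_string_code: "append_code s (string_code u) = string_code (s @ u)"
  by (induction s) (auto simp: string_code_def)

lemma total_recursive_append_code [recursive_intros]:
  assumes "total_recursive g k A"
  shows "total_recursive g k (\<lambda>xs. append_code s (A xs))"
  using assms by (induction s) (auto intro!: recursive_intros)

lemma list_decode_string_code [simp]: "list_decode (string_code s) = map of_bool s"
  by (simp add: string_code_def)

lemma binary_list_iff: "(\<forall>x\<in>set (list_decode c). x \<le> 1) \<longleftrightarrow> (\<exists>s. c = string_code s)"
proof
  assume *: "\<forall>x\<in>set (list_decode c). x \<le> 1"
  have "map of_bool (map (\<lambda>x. x = 1) (list_decode c)) = list_decode c"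
    using * by (auto simp: comp_def le_Suc_eq intro!: map_idI)
  then have "c = string_code (map (\<lambda>x. x = 1) (list_decode c))"
    unfolding string_code_def by (metis list_decode_inverse)
  then show "\<exists>s. c = string_code s" ..
qed auto

lemma list_lookup_initial_segment:
  "list_lookup (string_code (initial_segment X n)) x = (if x < n then Some (char_fun X x) else None)"
  by (auto simp: list_lookup_def initial_segment_def char_fun_def)

lemma one_generic_computes_no_generic_description:
  assumes f: "\<not> generically_computable f" and X: "one_generic_in f X"
    and d: "partial_computable_in (char_fun X) d"
  shows "\<not> generic_description d f"
proof
  assume desc: "generic_description d f"
  obtain p where p: "\<And>n. d n = run (char_fun X) p [n]"
    using d unfolding partial_computable_in_def by blast
  \<comment> \<open>The code \<open>c\<close> is both oracle and fuel. The code of an initial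
    segment is at least its length, so the fuel grows with the oracle.\<close>
  define E where "E c n = bounded_run (list_lookup c) c p [n]" for c n
  have E_rec: "total_recursive g k (\<lambda>xs. option_code (E (C xs) (N xs)))"
    if "total_recursive g k C" "total_recursive g k N" for g k C N
    using total_recursive_bounded_run[where As = "[N]" and \<phi> = list_lookup and C = C and T = C and p = p]
      that by (simp add: E_def total_recursive_list_lookup)
  have sound: "d n = Some v" if "E (string_code (initial_segment X m)) n = Some v" for m n v
    unfolding p using that unfolding E_def
    by (rule bounded_run_sound) (auto simp: list_lookup_initial_segment split: if_splits)
  have complete: "\<forall>\<^sub>F m in sequentially. E (string_code (initial_segment X m)) n = Some v"
    if "d n = Some v" for n v
    unfolding E_def
  proof (rule bounded_run_complete)
    show "run (char_fun X) p [n] = Some v" using that p by simp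
    show "\<forall>\<^sub>F m in sequentially.
        list_lookup (string_code (initial_segment X m)) x = Some (char_fun X x)" for x
      by (rule eventually_sequentiallyI[of "Suc x"]) (simp add: list_lookup_initial_segment)
    show "\<forall>\<^sub>F m in sequentially. k < string_code (initial_segment X m)" for k
    proof (rule eventually_sequentiallyI[of "Suc k"])
      fix m assume "Suc k \<le> m"
      moreover have "m \<le> string_code (initial_segment X m)"
        using length_le_list_encode[of "map of_bool (initial_segment X m)"]
        by (simp add: string_code_def initial_segment_def)
      ultimately show "k < string_code (initial_segment X m)" by linarith
    qed
  qed
  define S where "S = {s. \<exists>n v. E (string_code s) n = Some v \<and> v \<noteq> f n}"
  \<comment> \<open>Membership in \<open>S\<close> as a search for \<open>n\<close> on input
    \<open>c\<close>: code 0 is divergence and \<open>Suc (f n)\<close> is the correct answer. This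
    comparison is where the oracle \<open>f\<close> is consulted.\<close>
  define P where "P n c \<longleftrightarrow> (\<forall>x\<in>set (list_decode c). x \<le> 1) \<and>
      option_code (E c n) \<noteq> 0 \<and> option_code (E c n) \<noteq> Suc (f n)" for n c
  have "partial_computable_in f (\<lambda>c. if \<exists>n. P n c then Some 0 else None)"
    unfolding P_def
    by (rule partial_computable_in_search[where V = "\<lambda>_ _. 0"];
        intro recursive_intros E_rec total_recursive_oracle[of f]) simp_all
  moreover have "string_code ` S = dom (\<lambda>c. if \<exists>n. P n c then Some (0::nat) else None)"
    unfolding P_def binary_list_iff S_def by (auto simp: dom_def intro!: imageI) blast
  ultimately have "ce_strings_in f S"
    unfolding ce_strings_in_def ce_in_def by blast
  moreover have "initial_segment X m \<notin> S" for m
  proof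
    assume "initial_segment X m \<in> S"
    then obtain n v where "E (string_code (initial_segment X m)) n = Some v" "v \<noteq> f n"
      unfolding S_def by blast
    then have "d n = Some v" "d n \<noteq> Some v"
      using sound[of m n v] desc domI[of d n v] unfolding generic_description_def by auto
    then show False by contradiction
  qed
  ultimately obtain m where m: "\<And>s. prefix (initial_segment X m) s \<Longrightarrow> s \<notin> S"
    using X unfolding one_generic_in_def by blast
  define \<sigma> where "\<sigma> = initial_segment X m"
  \<comment> \<open>Now \<open>c\<close> ranges over continuations of the fixed string, and
    \<open>f\<close> no longer occurs, so the test is decidable without an oracle.\<close>
  define Q where "Q c n \<longleftrightarrow> (\<forall>x\<in>set (list_decode c). x \<le> 1) \<and>
      option_code (E (append_code \<sigma> c) n) \<noteq> 0" for c n
  have "generically_computable f"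
  proof (rule generically_computable_if_search[OF desc])
    show "decidable_in (\<lambda>_. 0) 2 (\<lambda>xs. Q (xs ! 0) (xs ! 1))"
      unfolding Q_def by (intro recursive_intros E_rec) simp_all
    show "total_recursive (\<lambda>_. 0) 2 (\<lambda>xs. option_code (E (append_code \<sigma> (xs ! 0)) (xs ! 1)) - 1)"
      by (intro recursive_intros E_rec) simp_all
    show "option_code (E (append_code \<sigma> c) n) - 1 = f n" if "Q c n" for c n
    proof -
      obtain s where s: "c = string_code s" using \<open>Q c n\<close> binary_list_iff Q_def by blast
      obtain v where "E (string_code (\<sigma> @ s)) n = Some v"
        using \<open>Q c n\<close> s by (auto simp: Q_def append_code_string_code)
      moreover have "\<sigma> @ s \<notin> S" using m by (simp add: \<sigma>_def)
      ultimately show ?thesis using s by (auto simp: S_def append_code_string_code)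
    qed
    show "\<exists>c. Q c n" if n: "n \<in> dom d" for n
    proof -
      obtain v where "d n = Some v" using n by blast
      from complete[OF this] obtain M where
        "\<And>l. M \<le> l \<Longrightarrow> E (string_code (initial_segment X l)) n = Some v"
        unfolding eventually_sequentially by blast
      \<comment> \<open>Length \<open>m + M\<close> is past the point of convergence and also
        extends the fixed initial segment of length \<open>m\<close>.\<close>
      then have "E (string_code (initial_segment X (m + M))) n = Some v" by simp
      moreover have "initial_segment X (m + M) = \<sigma> @ map (\<lambda>i. i \<in> X) [m..<m + M]"
        using upt_add_eq_append[of 0 m M] by (simp add: initial_segment_def \<sigma>_def)
      ultimately have "Q (string_code (map (\<lambda>i. i \<in> X) [m..<m + M])) n"
        unfolding Q_def binary_list_iff append_code_string_code by auto
      then show ?thesis ..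
    qed
  qed
  with f show False ..
qed

section \<open>Meagerness in Cantor space\<close>

definition cylinder :: "nat set \<Rightarrow> nat \<Rightarrow> nat set set" where
  "cylinder X n = {Y. \<forall>i<n. i \<in> Y \<longleftrightarrow> i \<in> X}"

text \<open>A basic open set of the product restricts finitely many coordinates, all below some
  \<open>n\<close>. Conversely, a cylinder is a product of singletons below \<open>n\<close> and
  full factors from \<open>n\<close> on.\<close>

lemma openin_cantor_space:
  "openin cantor_space U \<longleftrightarrow> (\<forall>X\<in>U. \<exists>n. cylinder X n \<subseteq> U)"
proof
  assume "openin cantor_space U"
  then obtain V where V: "openin (product_topology (\<lambda>_. discrete_topology UNIV) UNIV) V"
    and U: "U = (\<lambda>X n. n \<in> X) -` V"
    unfolding cantor_space_def openin_pullback_topology by auto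
  show "\<forall>X\<in>U. \<exists>n. cylinder X n \<subseteq> U"
  proof
    fix X assume "X \<in> U"
    then have "(\<lambda>n. n \<in> X) \<in> V" using U by simp
    then obtain B where fin: "finite {i. B i \<noteq> UNIV}" and X: "(\<lambda>n. n \<in> X) \<in> Pi\<^sub>E UNIV B"
      and B: "Pi\<^sub>E UNIV B \<subseteq> V"
      using V unfolding openin_product_topology_alt by fastforce
    obtain n where n: "{i. B i \<noteq> UNIV} \<subseteq> {..<n}"
      using fin finite_nat_iff_bounded by blast
    have "cylinder X n \<subseteq> U"
    proof
      fix Y assume Y: "Y \<in> cylinder X n"
      have "(i \<in> Y) \<in> B i" for i
      proof (cases "i < n")
        case True
        then show ?thesis using X Y by (auto simp: cylinder_def PiE_UNIV_domain Pi_iff)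
      next
        case False
        then have "B i = UNIV" using n by auto
        then show ?thesis by simp
      qed
      then show "Y \<in> U" using B U by (auto simp: PiE_UNIV_domain)
    qed
    then show "\<exists>n. cylinder X n \<subseteq> U" ..
  qed
next
  assume *: "\<forall>X\<in>U. \<exists>n. cylinder X n \<subseteq> U"
  define V where "V = {h. Collect h \<in> U}"
  have "openin (product_topology (\<lambda>_::nat. discrete_topology (UNIV :: bool set)) UNIV) V"
    unfolding openin_product_topology_alt
  proof
    fix h assume "h \<in> V"
    then obtain n where n: "cylinder (Collect h) n \<subseteq> U" using * V_def by auto
    define B where "B i = (if i < n then {h i} else UNIV)" for i
    have "finite {i. B i \<noteq> UNIV}"
      by (rule finite_subset[of _ "{..<n}"]) (auto simp: B_def)
    moreover have "h \<in> Pi\<^sub>E UNIV B" by (simp add: B_def PiE_UNIV_domain)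
    moreover have "Pi\<^sub>E UNIV B \<subseteq> V"
      using n by (auto simp: V_def cylinder_def B_def PiE_UNIV_domain Pi_iff subset_iff)
    ultimately show "\<exists>B. finite {i \<in> UNIV. B i \<noteq> topspace (discrete_topology UNIV)} \<and>
        (\<forall>i\<in>UNIV. openin (discrete_topology UNIV) (B i)) \<and> h \<in> Pi\<^sub>E UNIV B \<and> Pi\<^sub>E UNIV B \<subseteq> V"
      by (intro exI[of _ B]) simp
  qed
  moreover have "U = (\<lambda>X n. n \<in> X) -` V \<inter> UNIV" by (simp add: V_def vimage_def)
  ultimately show "openin cantor_space U"
    unfolding cantor_space_def openin_pullback_topology by blast
qed

lemma topspace_cantor_space [simp]: "topspace cantor_space = UNIV"
  using openin_subset[of cantor_space UNIV] by (auto simp: openin_cantor_space)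

text \<open>If the closure had interior, it would contain a cylinder. The point \<open>Y\<close> in
  it would then be a closure point whose open neighbourhood \<open>cylinder Y m\<close> misses
  \<open>M\<close>.\<close>

lemma nowhere_dense_in_cantor_spaceI:
  assumes "\<And>X n. \<exists>Y\<in>cylinder X n. \<exists>m. cylinder Y m \<inter> M = {}"
  shows "nowhere_dense_in cantor_space M"
proof -
  have False if X: "X \<in> cantor_space interior_of (cantor_space closure_of M)" for X
  proof -
    obtain n where n: "cylinder X n \<subseteq> cantor_space closure_of M"
      using X openin_cantor_space[of "cantor_space interior_of (cantor_space closure_of M)"]
        interior_of_subset[of cantor_space "cantor_space closure_of M"] by force
    obtain Y m where Y: "Y \<in> cylinder X n" "cylinder Y m \<inter> M = {}" using assms by blast
    have "openin cantor_space (cylinder Y m)"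
      unfolding openin_cantor_space by (auto simp: cylinder_def intro!: exI[of _ m])
    moreover have "Y \<in> cylinder Y m" by (simp add: cylinder_def)
    ultimately have "cylinder Y m \<inter> M \<noteq> {}"
      using Y(1) n unfolding closure_of_def by blast
    with Y(2) show False by contradiction
  qed
  then show ?thesis by (auto simp: nowhere_dense_in_def)
qed

text \<open>\<open>meager_in\<close> wants a sequence whose union is exactly \<open>S\<close>, so
  the pieces are intersected with \<open>S\<close> and enumerated, possibly with
  repetitions.\<close>

lemma meager_in_subset_countable_Union:
  assumes "countable I" and N: "\<And>i. i \<in> I \<Longrightarrow> nowhere_dense_in T (N i)" and S: "S \<subseteq> (\<Union>i\<in>I. N i)"
  shows "meager_in T S"
proof -
  define U where "U j = (if I = {} then {} else S \<inter> N (from_nat_into I j))" for j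
  have "nowhere_dense_in T (U j)" for j
  proof (cases "I = {}")
    case False
    then have *: "nowhere_dense_in T (N (from_nat_into I j))" by (intro N from_nat_into)
    have "U j \<subseteq> N (from_nat_into I j)" by (simp add: U_def)
    then show ?thesis
      using * interior_of_mono[OF closure_of_mono[of "U j" "N (from_nat_into I j)" T], of T]
      unfolding nowhere_dense_in_def by blast
  qed (simp add: U_def nowhere_dense_in_def)
  moreover have "S = (\<Union>j. U j)"
  proof (cases "I = {}")
    case False
    have "(\<Union>j. U j) = S \<inter> \<Union> (N ` range (from_nat_into I))" using False by (auto simp: U_def)
    then show ?thesis using S range_from_nat_into[OF False assms(1)] by auto
  qed (use S in \<open>simp add: U_def\<close>)
  ultimately show ?thesis unfolding meager_in_def by blast
qed

section \<open>Countability of the enumeration operators\<close>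

instance recfn :: countable
  by countable_datatype

lemma countable_enumeration_operators: "countable {W. enumeration_operator W}"
proof -
  define code where "code = (\<lambda>(F, k). prod_encode (set_encode F, k))"
  \<comment> \<open>Canonical indices separate finite sets only. Through this injection an operator
    is determined by its set of codes, which is the domain of one of countably many
    programs.\<close>
  have "inj_on code {(F, k). finite F}"
    by (auto simp: inj_on_def code_def prod_encode_eq set_encode_eq)
  then have "inj_on (image code) {W. enumeration_operator W}"
    by (intro inj_on_subset[OF inj_on_image_Pow]) (auto simp: enumeration_operator_def)
  moreover have "countable (image code ` {W. enumeration_operator W})"
  proof (rule countable_subset)
    show "countable (range (\<lambda>p. dom (\<lambda>n. run (\<lambda>_. 0) p [n])))" by simp
    show "image code ` {W. enumeration_operator W} \<subseteq> range (\<lambda>p. dom (\<lambda>n. run (\<lambda>_. 0) p [n]))"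
    proof
      fix C assume "C \<in> image code ` {W. enumeration_operator W}"
      then have "ce C" by (auto simp: enumeration_operator_def code_def)
      then obtain d p where "C = dom d" "\<forall>n. d n = run (\<lambda>_. 0) p [n]"
        unfolding ce_def partial_computable_def partial_computable_in_def by blast
      then have "C = dom (\<lambda>n. run (\<lambda>_. 0) p [n])" by (simp add: dom_def)
      then show "C \<in> range (\<lambda>p. dom (\<lambda>n. run (\<lambda>_. 0) p [n]))" by blast
    qed
  qed
  ultimately show ?thesis by (rule countable_image_inj_on[rotated])
qed

section \<open>Enumeration operators\<close>

text \<open>Lets a condition on all elements of a coded finite set be tested by a quantifier bounded
  by the code.\<close>

lemma in_set_decode_less: "j \<in> set_decode c \<Longrightarrow> j < c"
proof -
  assume "j \<in> set_decode c"
  then have "2 ^ j \<le> c"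
    unfolding set_decode_def by (metis div_less even_zero leI mem_Collect_eq)
  then show ?thesis using less_exp[of j] by linarith
qed

lemma gra_total_iff:
  "F \<subseteq> gra (\<lambda>n. Some (g n)) \<longleftrightarrow> (\<forall>j\<in>F. snd (prod_decode j) = g (fst (prod_decode j)))"
proof -
  have "gra (\<lambda>n. Some (g n)) = {j. snd (prod_decode j) = g (fst (prod_decode j))}"
    unfolding gra_def by (auto, metis prod.collapse prod_decode_inverse)
  then show ?thesis by auto
qed

text \<open>The use principle: \<open>F\<close> mentions finitely many arguments, and agreement with
  \<open>X\<close> on those suffices. Allowing every larger length lets the bound be combined with
  others.\<close>

lemma gra_char_fun_finite_use:
  assumes "finite F" and "F \<subseteq> gra (\<lambda>n. Some (char_fun X n))"
  shows "\<exists>N. \<forall>M\<ge>N. \<forall>Y\<in>cylinder X M. F \<subseteq> gra (\<lambda>n. Some (char_fun Y n))"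
proof -
  have "finite ((\<lambda>j. fst (prod_decode j)) ` F)" using assms(1) by simp
  then obtain N where "(\<lambda>j. fst (prod_decode j)) ` F \<subseteq> {..<N}"
    using finite_nat_iff_bounded by blast
  then have "F \<subseteq> gra (\<lambda>n. Some (char_fun Y n))" if "N \<le> M" "Y \<in> cylinder X M" for Y M
    using that assms(2) unfolding gra_total_iff
    by (fastforce simp: cylinder_def char_fun_def)
  then show ?thesis by blast
qed

lemma nowhere_dense_in_enum_apply:
  assumes A: "\<not> generically_computable h" and W: "enumeration_operator W"
  shows "nowhere_dense_in cantor_space
    {X. \<exists>e. generic_description e h \<and> gra e = enum_apply W (gra (\<lambda>n. Some (char_fun X n)))}"
    (is "nowhere_dense_in _ ?M")
proof (rule nowhere_dense_in_cantor_spaceI)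
  fix X n
  let ?g = "\<lambda>X. gra (\<lambda>n. Some (char_fun X n))"
  show "\<exists>Y\<in>cylinder X n. \<exists>m. cylinder Y m \<inter> ?M = {}"
  proof (cases "\<exists>Y\<in>cylinder X n. \<exists>a y. prod_encode (a, y) \<in> enum_apply W (?g Y) \<and> y \<noteq> h a")
    case True
    then obtain Y a y F where Y: "Y \<in> cylinder X n" and y: "y \<noteq> h a"
      and F: "(F, prod_encode (a, y)) \<in> W" "F \<subseteq> ?g Y"
      unfolding enum_apply_def by blast
    have "finite F" using F(1) W by (auto simp: enumeration_operator_def)
    from gra_char_fun_finite_use[OF this F(2)]
    obtain m where m: "\<forall>M\<ge>m. \<forall>Z\<in>cylinder Y M. F \<subseteq> ?g Z" ..
    have "prod_encode (a, y) \<in> enum_apply W (?g Z)" if "Z \<in> cylinder Y m" for Z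
      using F(1) m that unfolding enum_apply_def by blast
    moreover have "prod_encode (a, y) \<notin> gra e" if "generic_description e h" for e
      using that y domI[of e a y] by (auto simp: gra_def generic_description_def)
    ultimately have "cylinder Y m \<inter> ?M = {}" by blast
    with Y show ?thesis by blast
  next
    case False
    then have correct: "y = h a"
      if "Y \<in> cylinder X n" "prod_encode (a, y) \<in> enum_apply W (?g Y)" for Y a y
      using that by blast
    have "cylinder X n \<inter> ?M = {}"
    proof (rule ccontr)
      assume "cylinder X n \<inter> ?M \<noteq> {}"
      then obtain Y e where Y: "Y \<in> cylinder X n" and e: "generic_description e h"
        and gra: "gra e = enum_apply W (?g Y)" by blast
      obtain p where p: "(\<lambda>(F, k). prod_encode (set_encode F, k)) ` W = dom (\<lambda>z. run (\<lambda>_. 0) p [z])"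
      proof -
        obtain d p where "(\<lambda>(F, k). prod_encode (set_encode F, k)) ` W = dom d"
          "\<forall>z. d z = run (\<lambda>_. 0) p [z]"
          using W unfolding enumeration_operator_def ce_def partial_computable_def
            partial_computable_in_def by blast
        then show ?thesis using that by (simp add: dom_def)
      qed
      \<comment> \<open>Stagewise enumeration of \<open>W\<close>: the zero oracle is answered in
        full, so \<open>t\<close> is only a time bound.\<close>
      define H where "H t z = bounded_run (\<lambda>_. Some 0) t p [z]" for t z
      have H_rec: "total_recursive (\<lambda>_. 0) k (\<lambda>xs. option_code (H (T xs) (Z xs)))"
        if "total_recursive (\<lambda>_. 0) k T" "total_recursive (\<lambda>_. 0) k Z" for k T Z
        using total_recursive_bounded_run[where As = "[Z]" and \<phi> = "\<lambda>_ _. Some 0" and C = T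
            and T = T and p = p] that
        by (simp add: H_def total_recursive_const)
      have H_iff: "(\<exists>t. H t z \<noteq> None) \<longleftrightarrow> run (\<lambda>_. 0) p [z] \<noteq> None" for z
      proof
        assume "\<exists>t. H t z \<noteq> None"
        then show "run (\<lambda>_. 0) p [z] \<noteq> None"
          unfolding H_def using bounded_run_sound[of "\<lambda>_. Some 0" _ p "[z]" _ "\<lambda>_. 0"] by auto
      next
        assume "run (\<lambda>_. 0) p [z] \<noteq> None"
        then obtain v where "run (\<lambda>_. 0) p [z] = Some v" by blast
        then have "\<forall>\<^sub>F t in sequentially. H t z = Some v"
          unfolding H_def by (rule bounded_run_complete) (auto simp: eventually_gt_at_top)
        then obtain t where "H t z = Some v"
          using eventually_happens'[OF sequentially_bot] by blast
        then show "\<exists>t. H t z \<noteq> None" by blast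
      qed
      have W_iff: "(\<exists>t. H t (prod_encode (c, k)) \<noteq> None) \<longleftrightarrow> (set_decode c, k) \<in> W" for c k
      proof -
        have "(\<exists>t. H t (prod_encode (c, k)) \<noteq> None) \<longleftrightarrow>
            prod_encode (c, k) \<in> (\<lambda>(F, k). prod_encode (set_encode F, k)) ` W"
          unfolding H_iff p by blast
        also have "\<dots> \<longleftrightarrow> (set_decode c, k) \<in> W"
          using W by (force simp: enumeration_operator_def prod_encode_eq)
        finally show ?thesis .
      qed
      \<comment> \<open>The set \<open>X\<close> may be noncomputable, but its first
        \<open>n\<close> bits are a finite constant, which makes membership in the cylinder
        decidable.\<close>
      define x0 where "x0 = set_encode (X \<inter> {..<n})"
      have x0: "i \<in> set_decode x0 \<longleftrightarrow> i \<in> X" if "i < n" for i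
        using that by (simp add: x0_def)
      \<comment> \<open>\<open>x\<close> codes a finite set standing in for a point of the cylinder,
        \<open>c\<close> the finite set of an axiom of \<open>W\<close>, \<open>y\<close> the value
        announced at \<open>a\<close>, and \<open>t\<close> the stage at which the axiom has
        appeared.\<close>
      define Q where "Q x c y t a \<longleftrightarrow> (\<forall>i<n. i \<in> set_decode x \<longleftrightarrow> i \<in> set_decode x0) \<and>
          (\<forall>j<c. j \<in> set_decode c \<longrightarrow>
             snd (prod_decode j) = of_bool (fst (prod_decode j) \<in> set_decode x)) \<and>
          option_code (H t (prod_encode (c, prod_encode (a, y)))) \<noteq> 0" for x c y t a
      have Q_iff: "(\<exists>t. Q x c y t a) \<longleftrightarrow> set_decode x \<in> cylinder X n \<and>
          set_decode c \<subseteq> ?g (set_decode x) \<and> (set_decode c, prod_encode (a, y)) \<in> W" for x c y a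
        unfolding W_iff[symmetric] gra_total_iff Q_def
        by (auto simp: cylinder_def x0 char_fun_def in_set_decode_less)
      define P where "P w a \<longleftrightarrow> Q (fst (prod_decode w)) (fst (prod_decode (snd (prod_decode w))))
          (fst (prod_decode (snd (prod_decode (snd (prod_decode w))))))
          (snd (prod_decode (snd (prod_decode (snd (prod_decode w)))))) a" for w a
      define V where "V w a = fst (prod_decode (snd (prod_decode (snd (prod_decode w)))))"
        for w a :: nat
      have "generically_computable h"
      proof (rule generically_computable_if_search[OF e])
        show "decidable_in (\<lambda>_. 0) 2 (\<lambda>xs. P (xs ! 0) (xs ! 1))"
          unfolding P_def Q_def
          by (intro recursive_intros decidable_in_all_less H_rec; simp)
        show "total_recursive (\<lambda>_. 0) 2 (\<lambda>xs. V (xs ! 0) (xs ! 1))"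
          unfolding V_def by (intro recursive_intros; simp)
        \<comment> \<open>The finite set decoded from \<open>x\<close> is itself a point of the
          cylinder, so the failure of the first case applies to it.\<close>
        show "V w a = h a" if "P w a" for w a
          using that Q_iff correct unfolding P_def V_def enum_apply_def by blast
        show "\<exists>w. P w a" if a: "a \<in> dom e" for a
        proof -
          obtain y where "e a = Some y" using a by blast
          then have "prod_encode (a, y) \<in> enum_apply W (?g Y)"
            using gra unfolding gra_def by blast
          then obtain F where F: "(F, prod_encode (a, y)) \<in> W" "F \<subseteq> ?g Y"
            unfolding enum_apply_def by blast
          have fin: "finite F" using F(1) W by (auto simp: enumeration_operator_def)
          from gra_char_fun_finite_use[OF this F(2)]
          obtain N where N: "\<forall>M\<ge>N. \<forall>Z\<in>cylinder Y M. F \<subseteq> ?g Z" ..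
          \<comment> \<open>Cutting \<open>Y\<close> at \<open>n\<close> or later keeps it in the
            cylinder; cutting at \<open>N\<close> or later preserves the axiom's finite use.\<close>
          define x where "x = set_encode (Y \<inter> {..<max n N})"
          have x: "set_decode x = Y \<inter> {..<max n N}" by (simp add: x_def)
          have "F \<subseteq> ?g (set_decode x)"
            by (rule N[rule_format, of "max n N"]) (auto simp: x cylinder_def)
          moreover have "set_decode x \<in> cylinder X n" using Y by (auto simp: x cylinder_def)
          ultimately obtain t where "Q x (set_encode F) y t a"
            using Q_iff[of x "set_encode F" y a] F(1) fin by auto
          then have "P (prod_encode (x, prod_encode (set_encode F, prod_encode (y, t)))) a"
            by (simp add: P_def)
          then show ?thesis ..
        qed
      qed
      with A show False ..
    qed
    \<comment> \<open>The given cylinder already misses the set, so its centre \<open>X\<close> and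
      length \<open>n\<close> are the witnesses.\<close>
    then show ?thesis by (auto simp: cylinder_def)
  qed
qed

lemma ng_reducible_if_ug_reducible: "h \<le>\<^sub>u\<^sub>g g \<Longrightarrow> h \<le>\<^sub>n\<^sub>g g"
  unfolding ug_reducible_def ng_reducible_def by blast

text \<open>Feeding the total description of \<open>X\<close> to the reduction yields some
  \<open>W\<close>, so \<open>X\<close> lies in the nowhere dense set of that \<open>W\<close>. As
  \<open>W\<close> may vary with \<open>X\<close>, the nonuniform reducibility is covered as
  well.\<close>

lemma meager_in_subset_ng_reducible:
  assumes "\<not> generically_computable h" and "\<And>X. X \<in> S \<Longrightarrow> h \<le>\<^sub>n\<^sub>g char_fun X"
  shows "meager_in cantor_space S"
proof (rule meager_in_subset_countable_Union[OF countable_enumeration_operators])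
  show "nowhere_dense_in cantor_space
      {X. \<exists>e. generic_description e h \<and> gra e = enum_apply W (gra (\<lambda>n. Some (char_fun X n)))}"
    if "W \<in> {W. enumeration_operator W}" for W
    using that assms(1) by (simp add: nowhere_dense_in_enum_apply)
  show "S \<subseteq> (\<Union>W\<in>{W. enumeration_operator W}.
      {X. \<exists>e. generic_description e h \<and> gra e = enum_apply W (gra (\<lambda>n. Some (char_fun X n)))})"
    using assms(2) generic_description_total unfolding ng_reducible_def by blast
qed

theorem theorem6p8:
  shows "(\<forall>(f :: nat \<Rightarrow> nat) (X :: nat set).
            \<not> generically_computable f \<longrightarrow> one_generic_in f X \<longrightarrow>
            \<not> (\<exists>d. partial_computable_in (char_fun X) d \<and> generic_description d f)) \<and>
         (\<forall>A :: nat set. \<not> generically_computable (char_fun A) \<longrightarrow>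
            meager_in cantor_space {X. char_fun A \<le>\<^sub>u\<^sub>g char_fun X} \<and>
            meager_in cantor_space {X. char_fun A \<le>\<^sub>n\<^sub>g char_fun X})"
  using one_generic_computes_no_generic_description
  by (auto intro!: meager_in_subset_ng_reducible dest: ng_reducible_if_ug_reducible)

end
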